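(* Let $f\in\mathcal{G}(\Delta)$ be the generator of a one-parameter continuous semigroup on the open unit disk $\Delta$. Suppose that for some $\tau\in\partial\Delta$ and some $a\in\mathbb{C}$, $$f(z)=a(z-\tau)^{3}+o\left(|z-\tau|^{3}\right)$$ as $z\to\tau$ in each non-tangential approach region at $\tau$. Then $a\tau^{2}$ is a nonnegative real number. Moreover, $a=0$ if and only if $f\equiv 0$ on $\Delta$.
   Context: $\Delta=\{z\in\mathbb{C}:|z|<1\}$. A family $\{F_t\}_{t\ge 0}$ of holomorphic self-mappings of $\Delta$ is a one-parameter continuous semigroup on $\Delta$ if $F_t(F_s(z))=F_{t+s}(z)$ for all $t,s\ge 0$ and $\lim_{t\to 0^+}F_t(z)=z$ for all $z\in\Delta$. For such a family the limit $f(z)=\lim_{t\to 0^+}\frac{z-F_t(z)}{t}$ exists for every $z\in\Delta$ and defines a holomorphic function $f:\Delta\to\mathbb{C}$, called the (infinitesimal) generator of the semigroup; $u(t,z)=F_t(z)$ is the unique solution of $\partial u/\partial t+f(u)=0$, $u(0,z)=z$. $\mathcal{G}(\Delta)$ denotes the set of all such generators. *)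

theory Defs
  imports "HOL-Analysis.Analysis" "HOL-Library.Landau_Symbols" "HOL-Library.Nonpos_Ints"
begin

abbreviation unit_disk :: "complex set" where
  "unit_disk \<equiv> ball 0 1"

text \<open>
  A semigroup is a family \<open>F t\<close> indexed by real \<open>t\<close>, of which only the values at \<open>t \<ge> 0\<close> and at
  points of the disk matter. That \<open>F 0\<close> is the identity on the disk is a consequence.
\<close>

definition continuous_semigroup :: "(real \<Rightarrow> complex \<Rightarrow> complex) \<Rightarrow> bool" where
  "continuous_semigroup F \<longleftrightarrow>
     (\<forall>t\<ge>0. F t holomorphic_on unit_disk \<and> F t ` unit_disk \<subseteq> unit_disk) \<and>
     (\<forall>t\<ge>0. \<forall>s\<ge>0. \<forall>z\<in>unit_disk. F t (F s z) = F (t + s) z) \<and>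
     (\<forall>z\<in>unit_disk. ((\<lambda>t. F t z) \<longlongrightarrow> z) (at_right 0))"

definition is_generator_of :: "(complex \<Rightarrow> complex) \<Rightarrow> (real \<Rightarrow> complex \<Rightarrow> complex) \<Rightarrow> bool" where
  "is_generator_of f F \<longleftrightarrow>
     (\<forall>z\<in>unit_disk. ((\<lambda>t. (z - F t z) / of_real t) \<longlongrightarrow> f z) (at_right 0))"

text \<open>
  Generators are total functions in HOL; their values outside the disk are arbitrary.
\<close>

definition generators :: "(complex \<Rightarrow> complex) set" where
  "generators = {f. \<exists>F. continuous_semigroup F \<and> is_generator_of f F}"

text \<open>
  The non-tangential approach regions at a boundary point \<open>\<tau>\<close> are the Stolz regions with
  \<open>M > 1\<close>; for \<open>M \<le> 1\<close> the set below is empty.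
\<close>

definition approach_region :: "complex \<Rightarrow> real \<Rightarrow> complex set" where
  "approach_region \<tau> M = {z \<in> unit_disk. cmod (z - \<tau>) < M * (1 - cmod z)}"

end

theory Submission
  imports Defs "HOL-Complex_Analysis.Complex_Analysis"
begin

text \<open>
  Differentiating the Schwarz--Pick inequality for \<open>F t\<close> at \<open>t = 0\<close> gives a two-point inequality
  for \<open>f\<close>. Letting one point tend to \<open>\<tau>\<close> along the radius, where \<open>f\<close> vanishes to third
  order, yields \<open>f z = - \<tau> (1 - cnj \<tau> z)\<^sup>2 p z\<close> with \<open>Re p \<ge> 0\<close>, and the hypothesis becomes
  \<open>p z \<sim> a \<tau>\<^sup>2 (1 - cnj \<tau> z)\<close> in Stolz regions. Since \<open>1 - cnj \<tau> z\<close> takes all directions in the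
  right half plane, \<open>Re p \<ge> 0\<close> forces \<open>a \<tau>\<^sup>2 \<ge> 0\<close>. If \<open>a = 0\<close>, Harnack's inequality
  \<open>(1 - \<bar>z\<bar>) \<bar>p 0\<bar> \<le> (1 + \<bar>z\<bar>) \<bar>p z\<bar>\<close> gives \<open>p 0 = 0\<close>, and then \<open>p = 0\<close>.
  Pointwise convergence of the difference quotients makes \<open>f\<close> holomorphic by Montel's theorem:
  self-maps satisfy a bound on \<open>z - F z\<close> by its values at \<open>0\<close> and \<open>1/2\<close>.
\<close>

section \<open>The Schwarz--Pick inequality without quotients\<close>

lemma norm_moebius_identity:
  fixes z w :: complex
  shows "(cmod (1 - cnj w * z))\<^sup>2 - (cmod (z - w))\<^sup>2 = (1 - (cmod z)\<^sup>2) * (1 - (cmod w)\<^sup>2)"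
  by (simp only: cmod_power2) (simp add: algebra_simps power2_eq_square)

lemma one_minus_cnj_mult_nonzero:
  fixes z w :: complex
  assumes "cmod z < 1" "cmod w < 1"
  shows "1 - cnj w * z \<noteq> 0"
proof
  assume "1 - cnj w * z = 0"
  then have "cmod (cnj w * z) = 1"
    by (metis norm_one right_minus_eq)
  moreover have "cmod (cnj w * z) < 1"
    using norm_mult_less[of "cnj w" 1 z 1] assms by simp
  ultimately show False by simp
qed

text \<open>Moebius maps move \<open>w\<close> and \<open>F w\<close> to 0, and Schwarz's lemma
  applies to the conjugated map. Cleared of denominators and rewritten by
  \<open>norm_moebius_identity\<close>, the two sides coincide for \<open>F = id\<close>, which is
  what makes the inequality differentiable along a semigroup at time 0.\<close>

lemma schwarz_pick:
  assumes hol: "F holomorphic_on unit_disk" and im: "F ` unit_disk \<subseteq> unit_disk"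
    and z: "z \<in> unit_disk" and w: "w \<in> unit_disk"
  shows "(1 - (cmod z)\<^sup>2) * (1 - (cmod w)\<^sup>2) * (cmod (1 - cnj (F w) * F z))\<^sup>2
    \<le> (1 - (cmod (F z))\<^sup>2) * (1 - (cmod (F w))\<^sup>2) * (cmod (1 - cnj w * z))\<^sup>2"
proof -
  have z1: "cmod z < 1" and w1: "cmod w < 1" using z w by auto
  have Fz: "cmod (F z) < 1" and Fw: "cmod (F w) < 1" using im z w by (auto simp: image_subset_iff)
  define G where "G = Moebius_function 0 (F w) \<circ> F \<circ> Moebius_function 0 (- w)"
  have im_w: "Moebius_function 0 (- w) ` unit_disk \<subseteq> unit_disk"
    using Moebius_function_norm_lt_1 w1 by auto
  have hG: "G holomorphic_on ball 0 1"
    unfolding G_def o_assoc[symmetric]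
    by (rule holomorphic_on_compose_gen[where t = unit_disk]
          Moebius_function_holomorphic hol im_w Fw im
        | use w1 im im_w in \<open>force\<close>)+
  define \<xi> where "\<xi> = Moebius_function 0 w z"
  have xi: "cmod \<xi> < 1"
    using Moebius_function_norm_lt_1[OF w1 z1] by (simp add: \<xi>_def)
  have inv: "Moebius_function 0 (- w) \<xi> = z"
    unfolding \<xi>_def by (rule Moebius_function_compose) (use w1 z1 in auto)
  have "cmod (G \<xi>) \<le> cmod \<xi>"
  proof (rule Schwarz_Lemma(1)[OF hG _ _ xi])
    show "G 0 = 0"
      by (simp add: G_def Moebius_function_of_zero Moebius_function_eq_zero)
    show "cmod (G x) < 1" if "cmod x < 1" for x
    proof -
      have "F (Moebius_function 0 (- w) x) \<in> unit_disk"
        using that im im_w by (auto simp: image_subset_iff)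
      then show ?thesis
        using Moebius_function_norm_lt_1[OF Fw] by (simp add: G_def)
    qed
  qed
  then have "cmod (F z - F w) / cmod (1 - cnj (F w) * F z) \<le> cmod (z - w) / cmod (1 - cnj w * z)"
    by (simp add: G_def inv) (simp add: \<xi>_def Moebius_function_simple norm_divide)
  then have "cmod (F z - F w) * cmod (1 - cnj w * z) \<le> cmod (z - w) * cmod (1 - cnj (F w) * F z)"
    using one_minus_cnj_mult_nonzero[OF Fz Fw] one_minus_cnj_mult_nonzero[OF z1 w1]
    by (simp add: divide_simps)
  then have "(cmod (F z - F w) * cmod (1 - cnj w * z))\<^sup>2 \<le> (cmod (z - w) * cmod (1 - cnj (F w) * F z))\<^sup>2"
    by (intro power_mono) auto
  moreover have "(cmod (F z - F w))\<^sup>2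
      = (cmod (1 - cnj (F w) * F z))\<^sup>2 - (1 - (cmod (F z))\<^sup>2) * (1 - (cmod (F w))\<^sup>2)"
    "(cmod (z - w))\<^sup>2 = (cmod (1 - cnj w * z))\<^sup>2 - (1 - (cmod z)\<^sup>2) * (1 - (cmod w)\<^sup>2)"
    using norm_moebius_identity[of "F w" "F z"] norm_moebius_identity[of w z] by linarith+
  ultimately show ?thesis
    by (simp add: power_mult_distrib algebra_simps)
qed

section \<open>Harnack bounds for functions with nonnegative real part\<close>

text \<open>The Cayley-type map \<open>(q - q 0) / (q + cnj (q 0))\<close> sends the right half
  plane into the disk and \<open>q 0\<close> to 0, so this is Schwarz's lemma.\<close>

lemma caratheodory_ineq_pos:
  assumes hol: "q holomorphic_on unit_disk" and pos: "\<And>z. z \<in> unit_disk \<Longrightarrow> 0 < Re (q z)"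
    and z: "z \<in> unit_disk"
  shows "cmod (q z - q 0) \<le> cmod z * cmod (q z + cnj (q 0))"
proof -
  define g where "g x = (q x - q 0) / (q x + cnj (q 0))" for x
  have nz: "q x + cnj (q 0) \<noteq> 0" if "x \<in> unit_disk" for x
  proof
    assume "q x + cnj (q 0) = 0"
    then have "Re (q x + cnj (q 0)) = 0" by simp
    then show False using pos[OF that] pos[of 0] by simp
  qed
  have "cmod (g z) \<le> cmod z"
  proof (rule Schwarz_Lemma(1))
    show "g holomorphic_on ball 0 1"
      unfolding g_def using hol nz by (intro holomorphic_intros) auto
    show "g 0 = 0" by (simp add: g_def)
    show "cmod z < 1" using z by simp
    show "cmod (g x) < 1" if "cmod x < 1" for x
    proof -
      have x: "x \<in> unit_disk" using that by simp
      have "(cmod (q x + cnj (q 0)))\<^sup>2 - (cmod (q x - q 0))\<^sup>2 = 4 * Re (q x) * Re (q 0)"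
        by (simp only: cmod_power2) (simp add: algebra_simps power2_eq_square)
      also have "\<dots> > 0" using pos[OF x] pos[of 0] by simp
      finally have "(cmod (q x - q 0))\<^sup>2 < (cmod (q x + cnj (q 0)))\<^sup>2" by simp
      then have "cmod (q x - q 0) < cmod (q x + cnj (q 0))"
        by (rule power2_less_imp_less) simp
      then show ?thesis
        using nz[OF x] by (simp add: g_def norm_divide)
    qed
  qed
  then show ?thesis
    using nz[OF z] by (simp add: g_def norm_divide divide_simps)
qed

lemma caratheodory_ineq:
  assumes hol: "q holomorphic_on unit_disk" and pos: "\<And>z. z \<in> unit_disk \<Longrightarrow> 0 \<le> Re (q z)"
    and z: "z \<in> unit_disk"
  shows "cmod (q z - q 0) \<le> cmod z * cmod (q z + cnj (q 0))"
proof (rule field_le_epsilon)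
  fix e :: real assume e: "e > 0"
  have "cmod ((q z + e/2) - (q 0 + e/2)) \<le> cmod z * cmod ((q z + e/2) + cnj (q 0 + e/2))"
    by (rule caratheodory_ineq_pos[where q = "\<lambda>z. q z + e/2"])
      (use e pos z in \<open>auto intro!: holomorphic_intros hol add_nonneg_pos\<close>)
  also have "\<dots> = cmod z * cmod (q z + cnj (q 0) + e)"
    by (simp add: algebra_simps flip: of_real_add)
  also have "\<dots> \<le> cmod z * (cmod (q z + cnj (q 0)) + e)"
    using norm_triangle_ineq[of "q z + cnj (q 0)" "of_real e"] e by (intro mult_left_mono) auto
  also have "\<dots> \<le> cmod z * cmod (q z + cnj (q 0)) + e"
    using z e by (simp add: distrib_left)
  finally show "cmod (q z - q 0) \<le> cmod z * cmod (q z + cnj (q 0)) + e"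
    by simp
qed

text \<open>The triangle inequality turns Caratheodory's estimate into bounds on the modulus itself,
  so a zero of \<open>q\<close> at 0 makes \<open>q\<close> vanish identically.\<close>

lemma harnack_upper:
  assumes "q holomorphic_on unit_disk" "\<And>z. z \<in> unit_disk \<Longrightarrow> 0 \<le> Re (q z)" "z \<in> unit_disk"
  shows "(1 - cmod z) * cmod (q z) \<le> (1 + cmod z) * cmod (q 0)"
proof -
  have "cmod (q z) - cmod (q 0) \<le> cmod z * (cmod (q z) + cmod (q 0))"
    using caratheodory_ineq[OF assms] norm_triangle_ineq2[of "q z" "q 0"]
      mult_left_mono[OF norm_triangle_ineq[of "q z" "cnj (q 0)"], of "cmod z"] by simp
  then show ?thesis by (simp add: algebra_simps)
qed

lemma harnack_lower:
  assumes "q holomorphic_on unit_disk" "\<And>z. z \<in> unit_disk \<Longrightarrow> 0 \<le> Re (q z)" "z \<in> unit_disk"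
  shows "(1 - cmod z) * cmod (q 0) \<le> (1 + cmod z) * cmod (q z)"
proof -
  have "cmod (q 0) - cmod (q z) \<le> cmod z * (cmod (q z) + cmod (q 0))"
    using caratheodory_ineq[OF assms] norm_triangle_ineq2[of "q 0" "q z"]
      mult_left_mono[OF norm_triangle_ineq[of "q z" "cnj (q 0)"], of "cmod z"]
    by (simp add: norm_minus_commute)
  then show ?thesis by (simp add: algebra_simps)
qed

section \<open>Holomorphy of generators\<close>

text \<open>If \<open>F 0 = 0\<close> then \<open>F x = x * h x\<close> with
  \<open>cmod (h x) \<le> 1\<close>, and \<open>x - F x = x * q x\<close> where
  \<open>q = 1 - h\<close> has nonnegative real part; Harnack then carries control of
  \<open>q\<close> from 1/2 to every point. A Moebius map reduces to this case, with errors of order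
  \<open>cmod (F 0)\<close>. The bound is linear in the displacements, hence survives division by
  \<open>t\<close>.\<close>

lemma self_map_displacement_bound:
  assumes hol: "F holomorphic_on unit_disk" and im: "F ` unit_disk \<subseteq> unit_disk"
    and z: "z \<in> unit_disk"
  shows "(1 - cmod z)\<^sup>2 * cmod (z - F z) \<le> 26 * (cmod (1/2 - F (1/2)) + cmod (F 0))"
proof -
  define b where "b = F 0"
  define d where "d = cmod (1/2 - F (1/2))"
  have F1: "cmod (F x) < 1" if "x \<in> unit_disk" for x
    using im that by (auto simp: image_subset_iff)
  have b1: "cmod b < 1" using F1[of 0] by (simp add: b_def)
  define H where "H = Moebius_function 0 b \<circ> F"
  have hH: "H holomorphic_on ball 0 1"
    unfolding H_def
    by (rule holomorphic_on_compose_gen[OF hol Moebius_function_holomorphic[OF b1] im])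
  have H0: "H 0 = 0" by (simp add: H_def b_def Moebius_function_eq_zero)
  have H1: "cmod (H x) < 1" if "cmod x < 1" for x
    using Moebius_function_norm_lt_1[OF b1 F1] that by (simp add: H_def)
  obtain h where hh: "h holomorphic_on ball 0 1"
    and Hh: "\<And>x. cmod x < 1 \<Longrightarrow> H x = x * h x" and dh: "deriv H 0 = h 0"
    using Schwarz3[OF hH H0] by blast
  have h1: "cmod (h x) \<le> 1" if x: "x \<in> unit_disk" for x
  proof (cases "x = 0")
    case True
    then show ?thesis using Schwarz_Lemma(2)[OF hH H0 H1, of 0] dh by simp
  next
    case False
    have "cmod x * cmod (h x) \<le> cmod x * 1"
      using Schwarz_Lemma(1)[OF hH H0 H1, of x] Hh[of x] x by (simp add: norm_mult)
    then show ?thesis using False by simp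
  qed
  define q where "q x = 1 - h x" for x
  have hq: "q holomorphic_on unit_disk"
    unfolding q_def by (intro holomorphic_intros hh)
  have pq: "0 \<le> Re (q x)" if "x \<in> unit_disk" for x
    using h1[OF that] complex_Re_le_cmod[of "h x"] by (simp add: q_def)
  \<comment> \<open>Solving the Moebius relation for \<open>F x\<close> shows that, up to a
    denominator and terms of size \<open>cmod b\<close>, the displacement is
    \<open>x * q x\<close>.\<close>
  have id: "(x - F x) * (1 + cnj b * (x * h x)) = x * q x - b + cnj b * x\<^sup>2 * h x"
    if x: "x \<in> unit_disk" for x
  proof -
    have "x * h x = (F x - b) / (1 - cnj b * F x)"
      using Hh[of x] x by (simp add: H_def Moebius_function_simple)
    then have "x * h x * (1 - cnj b * F x) = F x - b"
      using one_minus_cnj_mult_nonzero[OF F1[OF x] b1] by simp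
    then show ?thesis unfolding q_def by algebra
  qed
  have err: "cmod (cnj b * x\<^sup>2 * h x) \<le> cmod b" if x: "x \<in> unit_disk" for x
  proof -
    have "cmod (x\<^sup>2) * cmod (h x) \<le> 1 * 1"
      using x h1[OF x] by (intro mult_mono) (auto simp: norm_power power_le_one)
    then show ?thesis
      using mult_left_mono[of "cmod (x\<^sup>2) * cmod (h x)" 1 "cmod b"] by (simp add: norm_mult mult.assoc)
  qed
  have small: "cmod (cnj b * (x * h x)) \<le> cmod x" if x: "x \<in> unit_disk" for x
  proof -
    have "cmod b * cmod (h x) \<le> 1 * 1"
      using b1 h1[OF x] by (intro mult_mono) auto
    then show ?thesis
      using mult_left_mono[of "cmod b * cmod (h x)" 1 "cmod x"] by (simp add: norm_mult mult_ac)
  qed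
  have half: "cmod (q (1/2)) \<le> 4 * (d + cmod b)"
  proof -
    have H: "(1/2::complex) \<in> unit_disk" by simp
    have "1/2 * q (1/2) = (1/2 - F (1/2)) * (1 + cnj b * (1/2 * h (1/2))) + b
        - cnj b * (1/2)\<^sup>2 * h (1/2)"
      using id[OF H] by simp
    then have "cmod (1/2 * q (1/2)) \<le> cmod ((1/2 - F (1/2)) * (1 + cnj b * (1/2 * h (1/2)))) + cmod b
        + cmod (cnj b * (1/2)\<^sup>2 * h (1/2))"
      by (metis (no_types, lifting) norm_triangle_ineq norm_triangle_ineq4 add_right_mono order_trans)
    moreover have "cmod ((1/2 - F (1/2)) * (1 + cnj b * (1/2 * h (1/2)))) \<le> d * 2"
      unfolding norm_mult[of "1/2 - F (1/2)"] d_def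
    proof (rule mult_left_mono)
      show "cmod (1 + cnj b * (1/2 * h (1/2))) \<le> 2"
        using small[OF H] norm_triangle_ineq[of 1 "cnj b * (1/2 * h (1/2))"] by simp
    qed simp
    ultimately show ?thesis using err[OF H] by (simp add: norm_mult)
  qed
  \<comment> \<open>Harnack from 1/2 to 0 costs (1 + 1/2)/(1 - 1/2) = 3, giving 3 * 4 = 12; going on
    to \<open>z\<close> doubles this to 24, and the two errors of size \<open>cmod b\<close> make
    26.\<close>
  have "cmod (q 0) \<le> 3 * cmod (q (1/2))"
    using harnack_lower[OF hq pq, of "1/2"] by simp
  then have q0: "cmod (q 0) \<le> 12 * (d + cmod b)"
    using half by simp
  have z1: "cmod z < 1" using z by simp
  have "(1 - cmod z) * cmod (q z) \<le> (1 + cmod z) * cmod (q 0)"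
    by (rule harnack_upper[OF hq pq z])
  also have "\<dots> \<le> 2 * (12 * (d + cmod b))"
    using z1 q0 by (intro mult_mono) auto
  finally have qz: "(1 - cmod z) * cmod (q z) \<le> 24 * (d + cmod b)" by simp
  \<comment> \<open>One factor \<open>1 - cmod z\<close> pays for the Moebius denominator, the other
    for Harnack; hence the square.\<close>
  have "(1 - cmod z) * cmod (z - F z) \<le> cmod (1 + cnj b * (z * h z)) * cmod (z - F z)"
  proof (rule mult_right_mono)
    show "1 - cmod z \<le> cmod (1 + cnj b * (z * h z))"
      using small[OF z] norm_diff_ineq[of 1 "cnj b * (z * h z)"] by simp
  qed simp
  also have "\<dots> = cmod (z * q z - b + cnj b * z\<^sup>2 * h z)"
    by (subst id[OF z, symmetric]) (simp add: norm_mult mult.commute)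
  also have "\<dots> \<le> cmod (z * q z) + cmod b + cmod (cnj b * z\<^sup>2 * h z)"
    by (metis norm_triangle_ineq norm_triangle_ineq4 add_right_mono order_trans)
  also have "\<dots> \<le> cmod (q z) + cmod b + cmod b"
    using err[OF z] mult_right_mono[of "cmod z" 1 "cmod (q z)"] z1 by (simp add: norm_mult)
  finally have "(1 - cmod z) * ((1 - cmod z) * cmod (z - F z)) \<le> (1 - cmod z) * (cmod (q z) + 2 * cmod b)"
    using z1 by (intro mult_left_mono) auto
  also have "\<dots> \<le> 24 * (d + cmod b) + 2 * cmod b"
    using qz mult_right_mono[of "1 - cmod z" 1 "2 * cmod b"] by (simp add: distrib_left)
  also have "\<dots> \<le> 26 * (d + cmod b)"
    by (simp add: d_def)
  finally show ?thesis
    by (simp add: power2_eq_square mult.assoc d_def b_def)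
qed

text \<open>\<open>is_generator_of\<close> supplies only pointwise limits. Local boundedness of the
  difference quotients gives a subsequence with a holomorphic limit, and that limit must be
  \<open>f\<close>.\<close>

lemma generator_holomorphic:
  assumes F: "continuous_semigroup F" and f: "is_generator_of f F"
  shows "f holomorphic_on unit_disk"
proof -
  define t where "t n = inverse (real (Suc n))" for n
  have t: "t n > 0" for n by (simp add: t_def)
  have t_lim: "filterlim t (at_right 0) sequentially"
    unfolding filterlim_at t_def using LIMSEQ_inverse_real_of_nat by auto
  define G where "G n z = (z - F (t n) z) / of_real (t n)" for n z
  have hF: "F (t n) holomorphic_on unit_disk" and iF: "F (t n) ` unit_disk \<subseteq> unit_disk" for n
    using F t[of n] by (auto simp: continuous_semigroup_def)
  have G_lim: "(\<lambda>n. G n z) \<longlonglongrightarrow> f z" if "z \<in> unit_disk" for z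
  proof -
    have "((\<lambda>t. (z - F t z) / of_real t) \<longlongrightarrow> f z) (at_right 0)"
      using f that by (simp add: is_generator_of_def)
    from filterlim_compose[OF this t_lim] show ?thesis by (simp add: G_def)
  qed
  have hG: "G n holomorphic_on unit_disk" for n
    unfolding G_def using t[of n] by (intro holomorphic_intros hF) auto
  \<comment> \<open>The displacement bound divided by \<open>t n\<close>: the right side stays
    bounded because the quotients converge at 0 and at 1/2.\<close>
  have G_bound: "(1 - cmod z)\<^sup>2 * cmod (G n z) \<le> 26 * (cmod (G n (1/2)) + cmod (G n 0))"
    if "z \<in> unit_disk" for n z
    using divide_right_mono[OF self_map_displacement_bound[OF hF[of n] iF[of n] that], of "t n"] t[of n]
    by (simp add: G_def norm_divide add_divide_distrib)
  have "Bseq (\<lambda>n. G n (1/2))" "Bseq (\<lambda>n. G n 0)"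
    using G_lim[of "1/2"] G_lim[of 0] by (auto intro: convergent_imp_Bseq convergentI)
  then obtain B1 B2 where B: "\<And>n. cmod (G n (1/2)) \<le> B1" "\<And>n. cmod (G n 0) \<le> B2"
    by (meson BseqE)
  have bdd: "\<exists>B. \<forall>h\<in>range G. \<forall>z\<in>K. cmod (h z) \<le> B" if K: "compact K" "K \<subseteq> unit_disk" for K
  proof -
    obtain r where r: "r < 1" "\<And>z. z \<in> K \<Longrightarrow> cmod z \<le> r"
    proof (cases "K = {}")
      case False
      obtain x where "x \<in> K" "\<And>z. z \<in> K \<Longrightarrow> cmod z \<le> cmod x"
        using continuous_attains_sup[OF K(1) False, of cmod] by (auto intro: continuous_intros)
      then show ?thesis using K(2) that[of "cmod x"] by auto
    qed (use that[of 0] in auto)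
    have "cmod (G n z) \<le> 26 * (B1 + B2) / (1 - r)\<^sup>2" if z: "z \<in> K" for n z
    proof -
      have "(1 - r)\<^sup>2 * cmod (G n z) \<le> (1 - cmod z)\<^sup>2 * cmod (G n z)"
        using r z by (intro mult_right_mono power_mono) auto
      also have "\<dots> \<le> 26 * (cmod (G n (1/2)) + cmod (G n 0))"
        using G_bound K z by auto
      also have "\<dots> \<le> 26 * (B1 + B2)"
        using B[of n] by simp
      finally show ?thesis using r(1) by (simp add: field_simps)
    qed
    then show ?thesis by blast
  qed
  obtain g r where g: "g holomorphic_on unit_disk" "strict_mono r"
    "\<And>z. z \<in> unit_disk \<Longrightarrow> (\<lambda>n. G (r n) z) \<longlonglongrightarrow> g z"
  proof (rule Montel[where \<H> = "range G" and \<F> = G and S = unit_disk])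
    show "h holomorphic_on unit_disk" if "h \<in> range G" for h
      using that hG by blast
  qed (use bdd in \<open>simp_all add: image_iff\<close>)
  have "g z = f z" if "z \<in> unit_disk" for z
    using LIMSEQ_unique[OF g(3)[OF that]] LIMSEQ_subseq_LIMSEQ[OF G_lim[OF that] g(2)]
    by (simp add: o_def)
  then show ?thesis
    using g(1) by (rule holomorphic_transform[rotated])
qed

section \<open>Infinitesimal Schwarz--Pick inequality\<close>

text \<open>The right derivative at \<open>t = 0\<close> of the Schwarz--Pick inequality for \<open>F t\<close>.\<close>

lemma generator_two_point:
  assumes F: "continuous_semigroup F" and f: "is_generator_of f F"
    and z: "z \<in> unit_disk" and w: "w \<in> unit_disk"
  shows "(1 - (cmod z)\<^sup>2) * (1 - (cmod w)\<^sup>2) * (2 * Re (cnj (1 - cnj w * z) * (cnj (f w) * z + cnj w * f z)))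
    \<le> (2 * Re (cnj z * f z) * (1 - (cmod w)\<^sup>2) + (1 - (cmod z)\<^sup>2) * (2 * Re (cnj w * f w)))
        * (cmod (1 - cnj w * z))\<^sup>2"
proof -
  \<comment> \<open>Exact increments, not Taylor expansions: \<open>1 - (cmod (F t x))^2\<close>
    grows by \<open>t * \<alpha> x t\<close>, and \<open>1 - cnj (F t w) * F t z\<close> by
    \<open>t * v t\<close>.\<close>
  define g where "g x t = (x - F t x) / of_real t" for x t
  define \<alpha> where "\<alpha> x t = 2 * Re (cnj x * g x t) - t * (cmod (g x t))\<^sup>2" for x t
  define v where "v t = cnj (g w t) * z + cnj w * g z t - of_real t * (cnj (g w t) * g z t)" for t
  define u where "u = 1 - cnj w * z"
  have g_lim: "(g x \<longlongrightarrow> f x) (at_right 0)" if "x \<in> unit_disk" for x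
    using f that by (simp add: is_generator_of_def g_def[abs_def])
  have t_lim: "((\<lambda>t. t) \<longlongrightarrow> 0) (at_right (0::real))"
    by (simp add: filterlim_ident tendsto_mono at_le)
  note lims = g_lim[OF z] g_lim[OF w] t_lim
  have v_lim: "(v \<longlongrightarrow> cnj (f w) * z + cnj w * f z - of_real 0 * (cnj (f w) * f z)) (at_right 0)"
    unfolding v_def by (intro tendsto_intros lims)
  have \<alpha>_lim: "(\<alpha> x \<longlongrightarrow> 2 * Re (cnj x * f x) - 0 * (cmod (f x))\<^sup>2) (at_right 0)"
    if "x \<in> unit_disk" for x
    unfolding \<alpha>_def by (intro tendsto_intros t_lim g_lim that)
  have ineq: "(1 - (cmod z)\<^sup>2) * (1 - (cmod w)\<^sup>2) * (2 * Re (cnj u * v t) + t * (cmod (v t))\<^sup>2)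
    \<le> (\<alpha> z t * (1 - (cmod w)\<^sup>2) + (1 - (cmod z)\<^sup>2) * \<alpha> w t + t * \<alpha> z t * \<alpha> w t) * (cmod u)\<^sup>2"
    (is "?l \<le> ?r") if t: "t > 0" for t
  proof -
    have Fx: "F t x = x - of_real t * g x t" for x using t by (simp add: g_def)
    have m: "1 - (cmod (F t x))\<^sup>2 = (1 - (cmod x)\<^sup>2) + t * \<alpha> x t" for x
      unfolding \<alpha>_def Fx by (simp only: cmod_power2) (simp add: algebra_simps power2_eq_square)
    have u: "1 - cnj (F t w) * F t z = u + of_real t * v t"
      unfolding Fx u_def v_def by (simp add: algebra_simps)
    have u2: "(cmod (u + of_real t * v t))\<^sup>2 = (cmod u)\<^sup>2 + t * (2 * Re (cnj u * v t) + t * (cmod (v t))\<^sup>2)"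
      by (simp only: cmod_power2) (simp add: algebra_simps power2_eq_square)
    have "F t holomorphic_on unit_disk" "F t ` unit_disk \<subseteq> unit_disk"
      using F t by (auto simp: continuous_semigroup_def)
    \<comment> \<open>The order-zero terms of both sides are equal and cancel, leaving a common
      factor \<open>t\<close>.\<close>
    from schwarz_pick[OF this z w] have "t * ?l \<le> t * ?r"
      unfolding m u u2 u_def[symmetric] by (simp add: algebra_simps)
    then show ?thesis using t by simp
  qed
  \<comment> \<open>The limits keep their vanishing terms so that they match the shape produced by
    \<open>tendsto_intros\<close>.\<close>
  have "(1 - (cmod z)\<^sup>2) * (1 - (cmod w)\<^sup>2) *
      (2 * Re (cnj u * (cnj (f w) * z + cnj w * f z - of_real 0 * (cnj (f w) * f z)))
        + 0 * (cmod (cnj (f w) * z + cnj w * f z - of_real 0 * (cnj (f w) * f z)))\<^sup>2)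
    \<le> ((2 * Re (cnj z * f z) - 0 * (cmod (f z))\<^sup>2) * (1 - (cmod w)\<^sup>2)
        + (1 - (cmod z)\<^sup>2) * (2 * Re (cnj w * f w) - 0 * (cmod (f w))\<^sup>2)
        + 0 * (2 * Re (cnj z * f z) - 0 * (cmod (f z))\<^sup>2) * (2 * Re (cnj w * f w) - 0 * (cmod (f w))\<^sup>2))
      * (cmod u)\<^sup>2"
  proof (rule tendsto_le)
    show "\<forall>\<^sub>F t in at_right 0. (1 - (cmod z)\<^sup>2) * (1 - (cmod w)\<^sup>2) * (2 * Re (cnj u * v t) + t * (cmod (v t))\<^sup>2)
    \<le> (\<alpha> z t * (1 - (cmod w)\<^sup>2) + (1 - (cmod z)\<^sup>2) * \<alpha> w t + t * \<alpha> z t * \<alpha> w t) * (cmod u)\<^sup>2"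
      using ineq by (auto intro: eventually_mono[OF eventually_at_right_less])
  qed (simp, (intro tendsto_intros \<alpha>_lim v_lim t_lim z w)+)
  then show ?thesis unfolding u_def by simp
qed

section \<open>Approach to the boundary point along rays\<close>

lemma norm_radius:
  fixes \<tau> :: complex
  assumes "cmod \<tau> = 1" "s \<le> 1"
  shows "cmod (\<tau> * (1 - of_real s)) = 1 - s"
proof -
  have "1 - complex_of_real s = of_real (1 - s)" by simp
  then show ?thesis using assms by (simp only: norm_mult norm_of_real) simp
qed

text \<open>Up to scaling, \<open>Re u = 1\<close> covers every direction pointing into the disk.
  With r the modulus of \<open>1 - s * u\<close>, r^2 = 1 - 2s + s^2 |u|^2 < 1 - s once s < 1/|u|^2.
  Hence s < 2(1 - r), and the distance s|u| to \<open>\<tau>\<close> is below 2|u|(1 - r), within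
  the stated aperture.\<close>

lemma stolz_ray:
  fixes u \<tau> :: complex
  assumes u: "Re u = 1" and \<tau>: "cmod \<tau> = 1"
  shows "filterlim (\<lambda>s. \<tau> * (1 - of_real s * u)) (at \<tau> within approach_region \<tau> (2 * cmod u + 1)) (at_right 0)"
proof -
  have t_lim: "((\<lambda>s. s) \<longlongrightarrow> 0) (at_right (0::real))"
    by (simp add: filterlim_ident tendsto_mono at_le)
  have lim: "((\<lambda>s. \<tau> * (1 - of_real s * u)) \<longlongrightarrow> \<tau> * (1 - of_real 0 * u)) (at_right 0)"
    by (intro tendsto_intros t_lim)
  have u0: "u \<noteq> 0" using u by auto
  have nu: "cmod u > 0" using u0 by simp
  have "\<forall>\<^sub>F s in at_right 0. s \<in> {0<..<1 / (cmod u)\<^sup>2}"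
    by (rule eventually_at_rightI[of 0 "1 / (cmod u)\<^sup>2"]) (use nu in auto)
  then have "\<forall>\<^sub>F s in at_right 0. \<tau> * (1 - of_real s * u) \<in> approach_region \<tau> (2 * cmod u + 1)
      \<and> \<tau> * (1 - of_real s * u) \<noteq> \<tau>"
  proof (rule eventually_mono)
    fix s :: real assume s: "s \<in> {0<..<1 / (cmod u)\<^sup>2}"
    define r where "r = cmod (1 - of_real s * u)"
    have s0: "s > 0" using s by simp
    have "s * (cmod u)\<^sup>2 < 1" using s nu by (simp add: field_simps)
    then have "s * (s * (cmod u)\<^sup>2) < s * 1" using s0 by (intro mult_strict_left_mono) auto
    moreover have "r\<^sup>2 = 1 - 2 * s + s * (s * (cmod u)\<^sup>2)"
      unfolding r_def by (simp only: cmod_power2) (use u in \<open>simp add: algebra_simps power2_eq_square\<close>)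
    ultimately have r2: "r\<^sup>2 < 1 - s" by simp
    have r0: "r \<ge> 0" by (simp add: r_def)
    have r1: "r < 1"
      using r2 s0 power2_less_imp_less[of r 1] by simp
    have "s < (1 - r) * (1 + r)"
      using r2 by (simp add: algebra_simps power2_eq_square)
    also have "\<dots> \<le> (1 - r) * 2"
      using r1 by (intro mult_left_mono) auto
    finally have s2: "s < 2 * (1 - r)" by simp
    have "s * cmod u < 2 * (1 - r) * cmod u"
      using s2 nu by simp
    also have "\<dots> < (2 * cmod u + 1) * (1 - r)"
      using r1 by (simp add: algebra_simps)
    finally have key: "s * cmod u < (2 * cmod u + 1) * (1 - r)" .
    have "\<tau> * (1 - of_real s * u) - \<tau> = - (\<tau> * (of_real s * u))" by (simp add: algebra_simps)
    then have "cmod (\<tau> * (1 - of_real s * u) - \<tau>) = s * cmod u"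
      using \<tau> s0 by (simp add: norm_mult)
    moreover have "cmod (\<tau> * (1 - of_real s * u)) = r"
      using \<tau> by (simp add: norm_mult r_def)
    moreover have "\<tau> * (1 - of_real s * u) \<noteq> \<tau>"
      using s0 u0 \<tau> by auto
    ultimately show "\<tau> * (1 - of_real s * u) \<in> approach_region \<tau> (2 * cmod u + 1)
      \<and> \<tau> * (1 - of_real s * u) \<noteq> \<tau>"
      using r1 key by (simp add: approach_region_def)
  qed
  then show ?thesis
    unfolding filterlim_at using lim by simp
qed

text \<open>On the ray, \<open>z - \<tau>\<close> is \<open>- s * \<tau> * u\<close>, so the
  little-o denominator is \<open>s^3\<close> times the constant \<open>c\<close>; multiplying by
  \<open>c\<close> leaves the quotient by \<open>s^3\<close>.\<close>

lemma ray_limit: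
  fixes u \<tau> a :: complex
  assumes u: "Re u = 1" and \<tau>: "cmod \<tau> = 1"
    and f: "\<And>M. M > 1 \<Longrightarrow>
           (\<lambda>z. f z - a * (z - \<tau>) ^ 3)
             \<in> o[at \<tau> within approach_region \<tau> M](\<lambda>z. complex_of_real (cmod (z - \<tau>) ^ 3))"
  shows "((\<lambda>s. f (\<tau> * (1 - of_real s * u)) / of_real s ^ 3) \<longlongrightarrow> - a * \<tau> ^ 3 * u ^ 3) (at_right 0)"
proof -
  have u0: "u \<noteq> 0" using u by auto
  define c where "c = complex_of_real (cmod u ^ 3)"
  define z where "z s = \<tau> * (1 - of_real s * u)" for s :: real
  have c0: "c \<noteq> 0" using u0 by (simp add: c_def)
  have "((\<lambda>x. (f x - a * (x - \<tau>) ^ 3) / complex_of_real (cmod (x - \<tau>) ^ 3)) \<longlongrightarrow> 0)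
      (at \<tau> within approach_region \<tau> (2 * cmod u + 1))"
    by (rule smalloD_tendsto[OF f]) (use u0 in simp)
  from filterlim_compose[OF this stolz_ray[OF u \<tau>]]
  have "((\<lambda>s. (f (z s) - a * (z s - \<tau>) ^ 3) / complex_of_real (cmod (z s - \<tau>) ^ 3)) \<longlongrightarrow> 0) (at_right 0)"
    by (simp add: z_def)
  then have "((\<lambda>s. c * ((f (z s) - a * (z s - \<tau>) ^ 3) / complex_of_real (cmod (z s - \<tau>) ^ 3))
      + - a * \<tau> ^ 3 * u ^ 3) \<longlongrightarrow> c * 0 + - a * \<tau> ^ 3 * u ^ 3) (at_right 0)"
    by (intro tendsto_intros)
  then have "((\<lambda>s. c * ((f (z s) - a * (z s - \<tau>) ^ 3) / complex_of_real (cmod (z s - \<tau>) ^ 3))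
      + - a * \<tau> ^ 3 * u ^ 3) \<longlongrightarrow> - a * \<tau> ^ 3 * u ^ 3) (at_right 0)" by simp
  then show ?thesis
  proof (rule Lim_transform_eventually)
    show "\<forall>\<^sub>F s in at_right 0. c * ((f (z s) - a * (z s - \<tau>) ^ 3) / complex_of_real (cmod (z s - \<tau>) ^ 3))
      + - a * \<tau> ^ 3 * u ^ 3 = f (\<tau> * (1 - of_real s * u)) / of_real s ^ 3"
    proof (rule eventually_mono[OF eventually_at_right_less])
      fix s :: real assume s: "0 < s"
      have d: "z s - \<tau> = - (of_real s * (\<tau> * u))" by (simp add: z_def algebra_simps)
      have n: "complex_of_real (cmod (z s - \<tau>) ^ 3) = of_real s ^ 3 * c"
        using s \<tau> by (simp add: d norm_mult c_def power_mult_distrib)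
      show "c * ((f (z s) - a * (z s - \<tau>) ^ 3) / complex_of_real (cmod (z s - \<tau>) ^ 3))
        + - a * \<tau> ^ 3 * u ^ 3 = f (\<tau> * (1 - of_real s * u)) / of_real s ^ 3"
        unfolding n z_def[symmetric] using s c0
        by (simp add: d power_mult_distrib divide_simps)
    qed
  qed
qed

section \<open>Positivity of the Berkson--Porta factor\<close>

text \<open>
  The Berkson--Porta factor \<open>p\<close> in \<open>f z = - \<tau> * (1 - cnj \<tau> * z)\<^sup>2 * p z\<close>.
\<close>

definition berkson_porta :: "complex \<Rightarrow> (complex \<Rightarrow> complex) \<Rightarrow> complex \<Rightarrow> complex" where
  "berkson_porta \<tau> f z = - cnj \<tau> * f z / (1 - cnj \<tau> * z)\<^sup>2"

lemma one_minus_cnj_boundary_nonzero: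
  assumes "cmod \<tau> = 1" "z \<in> unit_disk"
  shows "1 - cnj \<tau> * z \<noteq> 0"
proof
  assume "1 - cnj \<tau> * z = 0"
  then have "cmod (cnj \<tau> * z) = 1"
    by (metis norm_one right_minus_eq)
  then show False using assms by (simp add: norm_mult)
qed

text \<open>Let \<open>w\<close> tend to \<open>\<tau>\<close> along the radius in the two-point inequality, divided by \<open>1 - \<bar>w\<bar>\<^sup>2\<close>.\<close>

lemma berkson_porta_Re_nonneg:
  assumes F: "continuous_semigroup F" and f: "is_generator_of f F" and \<tau>: "cmod \<tau> = 1"
    and lim: "((\<lambda>s. f (\<tau> * (1 - of_real s)) / of_real s) \<longlongrightarrow> 0) (at_right 0)"
    and z: "z \<in> unit_disk"
  shows "0 \<le> Re (berkson_porta \<tau> f z)"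
proof -
  define w where "w s = \<tau> * (1 - of_real s)" for s :: real
  define g where "g s = f (w s) / of_real s" for s :: real
  define m where "m = 1 - (cmod z)\<^sup>2"
  have t_lim: "((\<lambda>s. s) \<longlongrightarrow> 0) (at_right (0::real))"
    by (simp add: filterlim_ident tendsto_mono at_le)
  have w_lim: "(w \<longlongrightarrow> \<tau> * (1 - of_real 0)) (at_right 0)"
    unfolding w_def by (intro tendsto_intros t_lim)
  have g_lim: "(g \<longlongrightarrow> 0) (at_right 0)" using lim by (simp add: g_def[abs_def] w_def)
  \<comment> \<open>On the radius \<open>1 - (cmod (w s))^2 = s * (2 - s)\<close>. Dividing by it
    leaves \<open>f (w s)\<close> only through \<open>s * g s\<close> and
    \<open>g s / (2 - s)\<close>, both of which vanish in the limit.\<close>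
  have ineq: "m * (2 * Re (cnj (1 - cnj (w s) * z) * (cnj (of_real s * g s) * z + cnj (w s) * f z)))
    \<le> (2 * Re (cnj z * f z) + m * (2 * Re (cnj (w s) * g s) / (2 - s))) * (cmod (1 - cnj (w s) * z))\<^sup>2"
    (is "?l \<le> ?r") if s: "s \<in> {0<..<1}" for s
  proof -
    have nw: "cmod (w s) = 1 - s"
      using norm_radius[OF \<tau>, of s] s by (simp add: w_def)
    have ns: "1 - (cmod (w s))\<^sup>2 = s * (2 - s)"
      unfolding nw by (simp add: power2_eq_square algebra_simps)
    have fw: "f (w s) = of_real s * g s" using s by (simp add: g_def)
    have pos: "s * (2 - s) > 0" using s by simp
    have "w s \<in> unit_disk" using nw s by simp
    from generator_two_point[OF F f z this]
    have "(s * (2 - s)) * ?l \<le> (2 * Re (cnj z * f z) * (s * (2 - s))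
        + m * (2 * Re (cnj (w s) * (of_real s * g s)))) * (cmod (1 - cnj (w s) * z))\<^sup>2"
      unfolding ns m_def[symmetric] fw by (simp add: mult_ac)
    also have "Re (cnj (w s) * (of_real s * g s)) = s * Re (cnj (w s) * g s)"
      by (simp add: algebra_simps)
    also have "(2 * Re (cnj z * f z) * (s * (2 - s)) + m * (2 * (s * Re (cnj (w s) * g s))))
      = (s * (2 - s)) * (2 * Re (cnj z * f z) + m * (2 * Re (cnj (w s) * g s) / (2 - s)))"
      using s by (simp add: field_simps)
    finally have "(s * (2 - s)) * ?l \<le> (s * (2 - s)) * ?r"
      by (simp only: mult.assoc)
    then show ?thesis by (rule mult_left_le_imp_le[OF _ pos])
  qed
  have "m * (2 * Re (cnj (1 - cnj (\<tau> * (1 - of_real 0)) * z)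
        * (cnj (of_real 0 * 0) * z + cnj (\<tau> * (1 - of_real 0)) * f z)))
    \<le> (2 * Re (cnj z * f z) + m * (2 * Re (cnj (\<tau> * (1 - of_real 0)) * 0) / (2 - 0)))
        * (cmod (1 - cnj (\<tau> * (1 - of_real 0)) * z))\<^sup>2"
  proof (rule tendsto_le)
    show "\<forall>\<^sub>F s in at_right 0. m * (2 * Re (cnj (1 - cnj (w s) * z) * (cnj (of_real s * g s) * z + cnj (w s) * f z)))
      \<le> (2 * Re (cnj z * f z) + m * (2 * Re (cnj (w s) * g s) / (2 - s))) * (cmod (1 - cnj (w s) * z))\<^sup>2"
      using ineq by (intro eventually_at_rightI[of 0 1]) auto
  qed (simp, (intro tendsto_intros w_lim g_lim t_lim; simp)+)
  then have le: "m * (2 * Re (cnj (1 - cnj \<tau> * z) * (cnj \<tau> * f z)))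
      \<le> 2 * Re (cnj z * f z) * (cmod (1 - cnj \<tau> * z))\<^sup>2" by simp
  define v where "v = 1 - cnj \<tau> * z"
  have v0: "v \<noteq> 0" using one_minus_cnj_boundary_nonzero[OF \<tau> z] by (simp add: v_def)
  have tt: "\<tau> * cnj \<tau> = 1" using \<tau> by (simp add: complex_norm_square[symmetric])
  \<comment> \<open>After removing the factor \<open>cnj v * f z\<close>, this says \<open>v * cnj z
    - (1 - z * cnj z) * cnj \<tau> = cnj z - cnj \<tau> = - cnj \<tau> * cnj v\<close>; the last
    equality uses \<open>\<tau> * cnj \<tau> = 1\<close>.\<close>
  have "of_real ((cmod v)\<^sup>2) * (cnj z * f z) - of_real m * (cnj v * (cnj \<tau> * f z))
      = - cnj \<tau> * f z * (cnj v)\<^sup>2"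
  proof -
    have "of_real ((cmod v)\<^sup>2) = v * cnj v" "of_real m = 1 - z * cnj z"
      unfolding m_def of_real_diff complex_norm_square by simp_all
    then show ?thesis unfolding v_def using tt by (simp add: power2_eq_square) algebra
  qed
  moreover have Re_real: "Re (of_real r * x) = r * Re x" for r x
    by simp
  ultimately have "Re (of_real ((cmod v)\<^sup>2) * (cnj z * f z) - of_real m * (cnj v * (cnj \<tau> * f z)))
      = Re (- cnj \<tau> * f z * (cnj v)\<^sup>2)" by simp
  then have *: "(cmod v)\<^sup>2 * Re (cnj z * f z) - m * Re (cnj v * (cnj \<tau> * f z))
      = Re (- cnj \<tau> * f z * (cnj v)\<^sup>2)"
    by (simp only: minus_complex.sel Re_real)
  have "m * (2 * Re (cnj v * (cnj \<tau> * f z))) \<le> 2 * Re (cnj z * f z) * (cmod v)\<^sup>2"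
    using le by (simp only: v_def)
  then have "2 * (m * Re (cnj v * (cnj \<tau> * f z))) \<le> 2 * ((cmod v)\<^sup>2 * Re (cnj z * f z))"
    by (simp only: mult.left_commute mult.commute mult.assoc)
  then have pos: "0 \<le> Re (- cnj \<tau> * f z * (cnj v)\<^sup>2)"
    unfolding *[symmetric] by simp
  \<comment> \<open>Since \<open>1 / v^2 = (cnj v)^2 / (cmod v)^4\<close>, the factor is a positive
    multiple of the quantity just bounded.\<close>
  have "berkson_porta \<tau> f z = - cnj \<tau> * f z * (cnj v)\<^sup>2 / of_real ((cmod v) ^ 4)"
  proof -
    have "complex_of_real ((cmod v) ^ 4) = (of_real ((cmod v)\<^sup>2))\<^sup>2" by simp
    also have "\<dots> = v\<^sup>2 * (cnj v)\<^sup>2"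
      unfolding complex_norm_square by (simp add: power_mult_distrib)
    finally show ?thesis using v0 by (simp add: berkson_porta_def v_def[symmetric])
  qed
  then have "Re (berkson_porta \<tau> f z) = Re (- cnj \<tau> * f z * (cnj v)\<^sup>2) / (cmod v) ^ 4"
    by (simp only: Re_divide_of_real)
  then show ?thesis
    using divide_nonneg_nonneg[OF pos, of "(cmod v) ^ 4"] by simp
qed

section \<open>The boundary coefficient and rigidity\<close>

theorem theorem1:
  fixes f :: "complex \<Rightarrow> complex" and \<tau> a :: complex
  assumes "f \<in> generators"
    and "\<tau> \<in> sphere 0 1"
    and "\<And>M. M > 1 \<Longrightarrow>
           (\<lambda>z. f z - a * (z - \<tau>) ^ 3)
             \<in> o[at \<tau> within approach_region \<tau> M](\<lambda>z. complex_of_real (cmod (z - \<tau>) ^ 3))"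
  shows "a * \<tau>\<^sup>2 \<in> \<real>\<^sub>\<ge>\<^sub>0 \<and> (a = 0 \<longleftrightarrow> (\<forall>z\<in>unit_disk. f z = 0))"
proof -
  obtain F where F: "continuous_semigroup F" and f: "is_generator_of f F"
    using assms(1) by (auto simp: generators_def)
  have \<tau>: "cmod \<tau> = 1" using assms(2) by simp
  have tt: "\<tau> * cnj \<tau> = 1" using \<tau> by (simp add: complex_norm_square[symmetric])
  note ray = ray_limit[OF _ \<tau> assms(3)]
  define p where "p = berkson_porta \<tau> f"
  have hp: "p holomorphic_on unit_disk"
    unfolding p_def berkson_porta_def
    by (intro holomorphic_intros generator_holomorphic[OF F f])
      (use one_minus_cnj_boundary_nonzero[OF \<tau>] in auto)
  \<comment> \<open>Along the radius, \<open>u = 1\<close>, third-order decay is more than the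
    \<open>f / s\<close> limit of zero that positivity of \<open>p\<close> requires.\<close>
  have "((\<lambda>s. of_real s ^ 2 * (f (\<tau> * (1 - of_real s * 1)) / of_real s ^ 3)) \<longlongrightarrow>
      of_real 0 ^ 2 * (- a * \<tau> ^ 3 * 1 ^ 3)) (at_right 0)"
    by (intro tendsto_intros ray) (simp_all add: filterlim_ident tendsto_mono at_le)
  then have "((\<lambda>s. of_real s ^ 2 * (f (\<tau> * (1 - of_real s * 1)) / of_real s ^ 3)) \<longlongrightarrow> 0) (at_right 0)"
    by simp
  then have "((\<lambda>s. f (\<tau> * (1 - of_real s)) / of_real s) \<longlongrightarrow> 0) (at_right 0)"
  proof (rule Lim_transform_eventually)
    show "\<forall>\<^sub>F s in at_right 0. of_real s ^ 2 * (f (\<tau> * (1 - of_real s * 1)) / of_real s ^ 3)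
        = f (\<tau> * (1 - of_real s)) / of_real s"
      by (rule eventually_mono[OF eventually_at_right_less])
        (simp add: power2_eq_square power3_eq_cube)
  qed
  then have p_Re: "0 \<le> Re (p z)" if "z \<in> unit_disk" for z
    using berkson_porta_Re_nonneg[OF F f \<tau> _ that] by (simp add: p_def)
  \<comment> \<open>On the ray \<open>1 - cnj \<tau> * z\<close> equals \<open>s * u\<close>, so
    \<open>p / s\<close> is \<open>- cnj \<tau> / u^2\<close> times \<open>f / s^3\<close>.\<close>
  have p_ray: "((\<lambda>s. p (\<tau> * (1 - of_real s * u)) / of_real s) \<longlongrightarrow> a * \<tau>\<^sup>2 * u) (at_right 0)"
    if u: "Re u = 1" for u
  proof -
    have u0: "u \<noteq> 0" using u by auto
    have "((\<lambda>s. - cnj \<tau> / u\<^sup>2 * (f (\<tau> * (1 - of_real s * u)) / of_real s ^ 3)) \<longlongrightarrow>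
        - cnj \<tau> / u\<^sup>2 * (- a * \<tau> ^ 3 * u ^ 3)) (at_right 0)"
      by (intro tendsto_intros ray[OF u])
    moreover have "- cnj \<tau> / u\<^sup>2 * (- a * \<tau> ^ 3 * u ^ 3) = a * \<tau>\<^sup>2 * u"
    proof -
      have "- cnj \<tau> / u\<^sup>2 * (- a * \<tau> ^ 3 * u ^ 3) = a * (\<tau> * cnj \<tau>) * \<tau>\<^sup>2 * u"
        using u0 by (simp add: power2_eq_square power3_eq_cube)
      then show ?thesis by (simp add: tt)
    qed
    moreover have "- cnj \<tau> / u\<^sup>2 * (f (\<tau> * (1 - of_real s * u)) / of_real s ^ 3)
        = p (\<tau> * (1 - of_real s * u)) / of_real s" for s
    proof -
      have "1 - cnj \<tau> * (\<tau> * (1 - of_real s * u)) = 1 - (\<tau> * cnj \<tau>) * (1 - of_real s * u)"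
        by (simp add: mult_ac)
      then have "1 - cnj \<tau> * (\<tau> * (1 - of_real s * u)) = of_real s * u" by (simp add: tt)
      then show ?thesis
        by (simp add: p_def berkson_porta_def power_mult_distrib power2_eq_square power3_eq_cube)
    qed
    ultimately show ?thesis by simp
  qed
  have ray_disk: "\<forall>\<^sub>F s in at_right 0. \<tau> * (1 - of_real s * u) \<in> unit_disk \<and> s > 0"
    if u: "Re u = 1" for u
  proof -
    have "\<forall>\<^sub>F s in at_right 0. \<tau> * (1 - of_real s * u) \<in> approach_region \<tau> (2 * cmod u + 1)"
      using stolz_ray[OF u \<tau>] unfolding filterlim_at by (auto elim: eventually_mono)
    then show ?thesis
      using eventually_at_right_less
      by eventually_elim (auto simp: approach_region_def)
  qed
  have pos: "0 \<le> Re (a * \<tau>\<^sup>2 * u)" if u: "Re u = 1" for u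
  proof (rule tendsto_lowerbound[OF tendsto_Re[OF p_ray[OF u]]])
    show "\<forall>\<^sub>F s in at_right 0. 0 \<le> Re (p (\<tau> * (1 - of_real s * u)) / of_real s)"
      using ray_disk[OF u] by eventually_elim (use p_Re in \<open>simp add: Re_divide_of_real\<close>)
  qed simp
  have "Im (a * \<tau>\<^sup>2) = 0"
  proof (rule ccontr)
    define c where "c = a * \<tau>\<^sup>2"
    assume "Im (a * \<tau>\<^sup>2) \<noteq> 0"
    then show False
      \<comment> \<open>With this imaginary part of \<open>u\<close>,
        \<open>Re (c * u) = Re c - Im c * Im u = -1\<close>, contradicting
        \<open>pos\<close>.\<close>
      using pos[of "Complex 1 ((Re c + 1) / Im c)"] unfolding c_def[symmetric] by simp
  qed
  then have real: "a * \<tau>\<^sup>2 \<in> \<real>\<^sub>\<ge>\<^sub>0"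
    using pos[of 1] by (simp add: complex_nonneg_Reals_iff)
  have "f z = 0" if a: "a = 0" and z: "z \<in> unit_disk" for z
  proof -
    \<comment> \<open>At distance \<open>s\<close> from \<open>\<tau>\<close> on the radius, Harnack
      gives \<open>s * cmod (p 0) \<le> (2 - s) * cmod (p x)\<close>. Dividing by \<open>s\<close>
      bounds \<open>p 0\<close> by the ray limit, which is 0 when \<open>a = 0\<close>.\<close>
    have "((\<lambda>s. 2 * cmod (p (\<tau> * (1 - of_real s * 1)) / of_real s)) \<longlongrightarrow> 2 * cmod (a * \<tau>\<^sup>2 * 1)) (at_right 0)"
      by (intro tendsto_intros p_ray) simp
    then have "cmod (p 0) \<le> 2 * cmod (a * \<tau>\<^sup>2 * 1)"
    proof (rule tendsto_lowerbound)
      show "\<forall>\<^sub>F s in at_right 0. cmod (p 0) \<le> 2 * cmod (p (\<tau> * (1 - of_real s * 1)) / of_real s)"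
      proof (rule eventually_at_rightI[of 0 1])
        fix s :: real assume s: "s \<in> {0<..<1}"
        define x where "x = \<tau> * (1 - of_real s * 1)"
        have nx: "cmod x = 1 - s"
          using norm_radius[OF \<tau>, of s] s by (simp add: x_def)
        then have "s * cmod (p 0) \<le> (2 - s) * cmod (p x)"
          using harnack_lower[OF hp p_Re, of x] s by simp
        also have "\<dots> \<le> 2 * cmod (p x)"
          using s by (intro mult_right_mono) auto
        finally show "cmod (p 0) \<le> 2 * cmod (p (\<tau> * (1 - of_real s * 1)) / of_real s)"
          unfolding x_def[symmetric] using s by (simp add: norm_divide field_simps)
      qed simp
    qed simp
    then have "p 0 = 0" using a by simp
    then have "p z = 0"
      using harnack_upper[OF hp p_Re z] z by (auto simp: mult_le_0_iff)
    then show ?thesis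
      using one_minus_cnj_boundary_nonzero[OF \<tau> z] \<tau> by (auto simp: p_def berkson_porta_def)
  qed
  moreover have "a = 0" if "\<forall>z\<in>unit_disk. f z = 0"
  proof -
    \<comment> \<open>If \<open>f\<close> vanishes on the disk, so does \<open>p\<close>, and its
      ray limit \<open>a * \<tau>^2\<close> for \<open>u = 1\<close> must be 0.\<close>
    have "\<forall>\<^sub>F s in at_right 0. p (\<tau> * (1 - of_real s * 1)) / of_real s = 0"
      using ray_disk[OF one_complex.sel(1)] by eventually_elim (use that in \<open>auto simp: p_def berkson_porta_def\<close>)
    then have "a * \<tau>\<^sup>2 * 1 = 0"
      by (intro tendsto_unique[OF _ p_ray tendsto_eventually]) simp_all
    then show ?thesis using \<tau> by auto
  qed
  ultimately show ?thesis using real by blast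
qed

end
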